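(* Let $A=(A,S,g)$ be a pivotal algebra over $k$ such that the algebra $A$ is separable, with separability idempotent $E=\sum E^1\otimes E^2\in A\otimes A$. Then, for all finite-dimensional left $A$-modules $V$, $$\nu(V)=\chi_V\Big(\sum S(E^1)\,g\,E^2\Big),$$ where $\chi_V:A\to k$ is the character (trace of the action) of $V$.
   Context: $k$ is a field of characteristic not two; algebras are unital associative $k$-algebras and $\otimes=\otimes_k$. A pivotal algebra is a triple $(A,S,g)$ consisting of an algebra $A$, an anti-algebra map $S:A\to A$ and an invertible element $g\in A$ such that $S(g)=g^{-1}$ and $S^2(a)=gag^{-1}$ for all $a\in A$. For a finite-dimensional left $A$-module $V$, the dual space $V^\vee=\mathrm{Hom}_k(V,k)$ is a left $A$-module by $\langle af,v\rangle=\langle f,S(a)v\rangle$, and $j_V:V\to V^{\vee\vee}$, $\langle j_V(v),f\rangle=\langle f,gv\rangle$, is an isomorphism of left $A$-modules. The Frobenius--Schur indicator $\nu(V)\in k$ is the trace of the $k$-linear map $\mathrm{Hom}_A(V,V^\vee)\to\mathrm{Hom}_A(V,V^\vee)$, $f\mapsto f^\vee\circ j_V$, where $f^\vee:V^{\vee\vee}\to V^\vee$ is the transpose of $f$. A separability idempotent of $A$ is an element $E=\sum E^1\otimes E^2\in A\otimes A$ such that $\sum E^1E^2=1$ and $\sum aE^1\otimes E^2=\sum E^1\otimes E^2a$ for all $a\in A$; $A$ is separable if such an element exists. *)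

theory Defs
  imports
    Complex_Main
    "HOL-Library.FuncSet"
    "HOL-Library.Function_Algebras"
    "HOL-Library.Poly_Mapping"
begin

section \<open>Algebras, pivotal algebras and modules\<close>

text \<open>
  The sort \<open>{ring, monoid_mult}\<close> is that of unital associative rings; unlike \<open>ring_1\<close> it
  does not exclude the zero ring.
\<close>

locale k_algebra = vector_space sA
  for sA :: "'k::field \<Rightarrow> 'a::{ring,monoid_mult} \<Rightarrow> 'a" +
  assumes scale_mult_left: "sA c x * y = sA c (x * y)"
    and scale_mult_right: "x * sA c y = sA c (x * y)"

locale pivotal_algebra = k_algebra sA
  for sA :: "'k::field \<Rightarrow> 'a::{ring,monoid_mult} \<Rightarrow> 'a" +
  fixes S :: "'a \<Rightarrow> 'a" and g :: 'a
  assumes linear_S: "Vector_Spaces.linear sA sA S"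
    and S_one: "S 1 = 1"
    and S_mult: "S (x * y) = S y * S x"
    and pivotal_element:
      "\<exists>ginv. g * ginv = 1 \<and> ginv * g = 1 \<and> S g = ginv \<and> (\<forall>a. S (S a) = g * a * ginv)"

locale left_module = A: k_algebra sA + V: vector_space sV
  for sA :: "'k::field \<Rightarrow> 'a::{ring,monoid_mult} \<Rightarrow> 'a"
    and sV :: "'k \<Rightarrow> 'v::ab_group_add \<Rightarrow> 'v" +
  fixes act :: "'a \<Rightarrow> 'v \<Rightarrow> 'v"
  assumes act_add_left: "act (a + b) v = act a v + act b v"
    and act_add_right: "act a (v + w) = act a v + act a w"
    and act_scale_left: "act (sA c a) v = sV c (act a v)"
    and act_scale_right: "act a (sV c v) = sV c (act a v)"
    and act_one: "act 1 v = v"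
    and act_mult: "act (a * b) v = act a (act b v)"

definition finite_dimensional :: "('k::field \<Rightarrow> 'v::ab_group_add \<Rightarrow> 'v) \<Rightarrow> bool" where
  "finite_dimensional sV \<longleftrightarrow> (\<exists>B. finite_dimensional_vector_space sV B)"


section \<open>Traces\<close>

definition is_basis_of :: "('k::field \<Rightarrow> 'v::ab_group_add \<Rightarrow> 'v) \<Rightarrow> 'v set \<Rightarrow> 'v set \<Rightarrow> bool" where
  "is_basis_of sV W B \<longleftrightarrow> \<not> module.dependent sV B \<and> module.span sV B = W"

text \<open>
  The trace of an endomorphism \<open>T\<close> of a finite-dimensional subspace \<open>W\<close>: the sum of the diagonal
  entries of the matrix of \<open>T\<close> in a basis. Lemma \<open>trace_on_eq\<close> below shows that the choice of
  the basis is irrelevant.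
\<close>

definition trace_on :: "('k::field \<Rightarrow> 'v::ab_group_add \<Rightarrow> 'v) \<Rightarrow> 'v set \<Rightarrow> ('v \<Rightarrow> 'v) \<Rightarrow> 'k" where
  "trace_on sV W T =
    (let B = (SOME B. is_basis_of sV W B) in \<Sum>b\<in>B. module.representation sV B (T b) b)"

definition character ::
    "('k::field \<Rightarrow> 'v::ab_group_add \<Rightarrow> 'v) \<Rightarrow> ('a \<Rightarrow> 'v \<Rightarrow> 'v) \<Rightarrow> 'a \<Rightarrow> 'k" where
  "character sV act a = trace_on sV UNIV (act a)"


section \<open>Duality and the Frobenius--Schur indicator\<close>

definition dual :: "('k::field \<Rightarrow> 'v::ab_group_add \<Rightarrow> 'v) \<Rightarrow> ('v \<Rightarrow> 'k) set" where
  "dual sV = {\<phi>. Vector_Spaces.linear sV (*) \<phi>}"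

definition dual_scale :: "'k::field \<Rightarrow> ('v \<Rightarrow> 'k) \<Rightarrow> 'v \<Rightarrow> 'k" where
  "dual_scale c \<phi> = (\<lambda>v. c * \<phi> v)"

definition dual_act :: "('a \<Rightarrow> 'v \<Rightarrow> 'v) \<Rightarrow> ('a \<Rightarrow> 'a) \<Rightarrow> 'a \<Rightarrow> ('v \<Rightarrow> 'k) \<Rightarrow> 'v \<Rightarrow> 'k" where
  "dual_act act S a \<phi> = (\<lambda>v. \<phi> (act (S a) v))"

text \<open>
  \<open>Hom\<^sub>A(V, W)\<close> where \<open>V\<close> is a whole type and \<open>W\<close> is a subset of a type.
\<close>

definition module_homs ::
    "('k::field \<Rightarrow> 'v::ab_group_add \<Rightarrow> 'v) \<Rightarrow> ('a \<Rightarrow> 'v \<Rightarrow> 'v) \<Rightarrow>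
     ('k \<Rightarrow> 'w::ab_group_add \<Rightarrow> 'w) \<Rightarrow> ('a \<Rightarrow> 'w \<Rightarrow> 'w) \<Rightarrow> 'w set \<Rightarrow> ('v \<Rightarrow> 'w) set" where
  "module_homs sV actV sW actW W =
    {f. Vector_Spaces.linear sV sW f \<and> range f \<subseteq> W \<and> (\<forall>a v. f (actV a v) = actW a (f v))}"

definition hom_to_dual ::
    "('k::field \<Rightarrow> 'v::ab_group_add \<Rightarrow> 'v) \<Rightarrow> ('a \<Rightarrow> 'v \<Rightarrow> 'v) \<Rightarrow> ('a \<Rightarrow> 'a) \<Rightarrow> ('v \<Rightarrow> 'v \<Rightarrow> 'k) set" where
  "hom_to_dual sV act S = module_homs sV act dual_scale (dual_act act S) (dual sV)"

definition hom_scale :: "'k::field \<Rightarrow> ('v \<Rightarrow> 'v \<Rightarrow> 'k) \<Rightarrow> 'v \<Rightarrow> 'v \<Rightarrow> 'k" where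
  "hom_scale c f = (\<lambda>v. dual_scale c (f v))"

text \<open>
  Elements of the bidual are functions with domain \<open>dual sV\<close>, hence the bounded abstraction.
\<close>

definition pivotal_map ::
    "('k::field \<Rightarrow> 'v::ab_group_add \<Rightarrow> 'v) \<Rightarrow> ('a \<Rightarrow> 'v \<Rightarrow> 'v) \<Rightarrow> 'a \<Rightarrow> 'v \<Rightarrow> ('v \<Rightarrow> 'k) \<Rightarrow> 'k" where
  "pivotal_map sV act g v = (\<lambda>\<phi>\<in>dual sV. \<phi> (act g v))"

definition transpose_map :: "('v \<Rightarrow> 'w) \<Rightarrow> ('w \<Rightarrow> 'k) \<Rightarrow> 'v \<Rightarrow> 'k" where
  "transpose_map f \<psi> = \<psi> \<circ> f"

definition fs_indicator ::
    "('k::field \<Rightarrow> 'v::ab_group_add \<Rightarrow> 'v) \<Rightarrow> ('a \<Rightarrow> 'v \<Rightarrow> 'v) \<Rightarrow> ('a \<Rightarrow> 'a) \<Rightarrow> 'a \<Rightarrow> 'k" where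
  "fs_indicator sV act S g =
    trace_on hom_scale (hom_to_dual sV act S) (\<lambda>f. transpose_map f \<circ> pivotal_map sV act g)"


section \<open>The tensor product \<open>A \<otimes> A\<close> and separability idempotents\<close>

text \<open>
  The tensor product is the quotient of the vector space with basis \<open>'a \<times> 'a\<close> by the bilinearity
  relations; tensors are cosets.
\<close>

definition free_scale :: "'k::field \<Rightarrow> ('x \<Rightarrow>\<^sub>0 'k) \<Rightarrow> ('x \<Rightarrow>\<^sub>0 'k)" where
  "free_scale c = Poly_Mapping.map ((*) c)"

definition bilinear_relations ::
    "('k::field \<Rightarrow> 'a::ab_group_add \<Rightarrow> 'a) \<Rightarrow> ('a \<times> 'a \<Rightarrow>\<^sub>0 'k) set" where
  "bilinear_relations sA =
     {Poly_Mapping.single (a + b, x) 1 - Poly_Mapping.single (a, x) 1 - Poly_Mapping.single (b, x) 1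
       | a b x. True} \<union>
     {Poly_Mapping.single (x, a + b) 1 - Poly_Mapping.single (x, a) 1 - Poly_Mapping.single (x, b) 1
       | a b x. True} \<union>
     {Poly_Mapping.single (sA c a, x) 1 - Poly_Mapping.single (a, x) c | a c x. True} \<union>
     {Poly_Mapping.single (x, sA c a) 1 - Poly_Mapping.single (x, a) c | a c x. True}"

definition tensor_rel ::
    "('k::field \<Rightarrow> 'a::ab_group_add \<Rightarrow> 'a) \<Rightarrow> (('a \<times> 'a \<Rightarrow>\<^sub>0 'k) \<times> ('a \<times> 'a \<Rightarrow>\<^sub>0 'k)) set" where
  "tensor_rel sA = {(s, t). s - t \<in> module.span free_scale (bilinear_relations sA)}"

definition tensor_class ::
    "('k::field \<Rightarrow> 'a::ab_group_add \<Rightarrow> 'a) \<Rightarrow> ('a \<times> 'a \<Rightarrow>\<^sub>0 'k) \<Rightarrow> ('a \<times> 'a \<Rightarrow>\<^sub>0 'k) set" where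
  "tensor_class sA s = tensor_rel sA `` {s}"

definition tensor_space ::
    "('k::field \<Rightarrow> 'a::ab_group_add \<Rightarrow> 'a) \<Rightarrow> ('a \<times> 'a \<Rightarrow>\<^sub>0 'k) set set" where
  "tensor_space sA = UNIV // tensor_rel sA"

text \<open>
  In Sweedler notation, \<open>tensor_lift sX \<beta> E = \<Sum> \<beta>(E\<^sup>1, E\<^sup>2)\<close> for \<open>\<beta>\<close> bilinear and
  \<open>tensor_map sA p q E = \<Sum> p(E\<^sup>1) \<otimes> q(E\<^sup>2)\<close> for \<open>p\<close> and \<open>q\<close> linear: both are computed on any
  representative of the coset (see \<open>tensor_lift_class\<close> and \<open>tensor_map_class\<close>).
\<close>

definition free_lift ::
    "('k::field \<Rightarrow> 'x::ab_group_add \<Rightarrow> 'x) \<Rightarrow> ('a \<Rightarrow> 'a \<Rightarrow> 'x) \<Rightarrow> ('a \<times> 'a \<Rightarrow>\<^sub>0 'k) \<Rightarrow> 'x" where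
  "free_lift sX \<beta> s = (\<Sum>(a, b)\<in>Poly_Mapping.keys s. sX (Poly_Mapping.lookup s (a, b)) (\<beta> a b))"

definition tensor_lift ::
    "('k::field \<Rightarrow> 'x::ab_group_add \<Rightarrow> 'x) \<Rightarrow> ('a \<Rightarrow> 'a \<Rightarrow> 'x) \<Rightarrow> ('a \<times> 'a \<Rightarrow>\<^sub>0 'k) set \<Rightarrow> 'x" where
  "tensor_lift sX \<beta> E = the_elem (free_lift sX \<beta> ` E)"

definition tensor_map ::
    "('k::field \<Rightarrow> 'a::ab_group_add \<Rightarrow> 'a) \<Rightarrow> ('a \<Rightarrow> 'a) \<Rightarrow> ('a \<Rightarrow> 'a) \<Rightarrow>
     ('a \<times> 'a \<Rightarrow>\<^sub>0 'k) set \<Rightarrow> ('a \<times> 'a \<Rightarrow>\<^sub>0 'k) set" where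
  "tensor_map sA p q E =
    the_elem ((\<lambda>s. tensor_class sA
      (free_lift free_scale (\<lambda>a b. Poly_Mapping.single (p a, q b) 1) s)) ` E)"

definition separability_idempotent ::
    "('k::field \<Rightarrow> 'a::{ring,monoid_mult} \<Rightarrow> 'a) \<Rightarrow> ('a \<times> 'a \<Rightarrow>\<^sub>0 'k) set \<Rightarrow> bool" where
  "separability_idempotent sA E \<longleftrightarrow>
    E \<in> tensor_space sA \<and>
    tensor_lift sA (\<lambda>x y. x * y) E = 1 \<and>
    (\<forall>a. tensor_map sA (\<lambda>x. a * x) id E = tensor_map sA id (\<lambda>y. y * a) E)"


section \<open>The definitions do not depend on the choices made\<close>

lemma lookup_free_scale [simp]:
  "Poly_Mapping.lookup (free_scale c s) x = c * Poly_Mapping.lookup s x"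
  by (simp add: free_scale_def Poly_Mapping.map.rep_eq when_def)

lemma vector_space_free_scale: "vector_space (free_scale :: 'k::field \<Rightarrow> ('x \<Rightarrow>\<^sub>0 'k) \<Rightarrow> _)"
  by unfold_locales (rule poly_mapping_eqI; simp add: lookup_add algebra_simps)+

lemma equiv_tensor_rel: "equiv UNIV (tensor_rel sA)"
proof -
  interpret F: vector_space "free_scale :: 'k::field \<Rightarrow> ('a \<times> 'a \<Rightarrow>\<^sub>0 'k) \<Rightarrow> _"
    by (rule vector_space_free_scale)
  show ?thesis
  proof (rule equivI)
    show "refl (tensor_rel sA)"
      by (auto simp: refl_on_def tensor_rel_def F.span_zero)
    show "sym (tensor_rel sA)"
      unfolding sym_def tensor_rel_def using F.span_neg by fastforce
    show "trans (tensor_rel sA)"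
      unfolding trans_def tensor_rel_def using F.span_add by fastforce
  qed auto
qed

lemma free_lift_eq_sum:
  assumes "vector_space sX" "finite K" "Poly_Mapping.keys s \<subseteq> K"
  shows "free_lift sX \<beta> s = (\<Sum>(a, b)\<in>K. sX (Poly_Mapping.lookup s (a, b)) (\<beta> a b))"
proof -
  interpret X: vector_space sX by fact
  show ?thesis unfolding free_lift_def
    by (rule sum.mono_neutral_left) (use assms in \<open>auto simp: in_keys_iff\<close>)
qed

lemma free_lift_linear:
  assumes "vector_space sX"
  shows "Vector_Spaces.linear free_scale sX (free_lift sX \<beta>)"
proof -
  interpret X: vector_space sX by fact
  interpret F: vector_space "free_scale :: 'a \<Rightarrow> ('c \<times> 'c \<Rightarrow>\<^sub>0 'a) \<Rightarrow> _"
    by (rule vector_space_free_scale)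
  show ?thesis
  proof unfold_locales
    fix s t :: "'c \<times> 'c \<Rightarrow>\<^sub>0 'a" and c :: 'a
    define K where "K = Poly_Mapping.keys s \<union> Poly_Mapping.keys t"
    have K: "finite K" "Poly_Mapping.keys s \<subseteq> K" "Poly_Mapping.keys t \<subseteq> K"
      "Poly_Mapping.keys (s + t) \<subseteq> K" "Poly_Mapping.keys (free_scale c s) \<subseteq> K"
      using Poly_Mapping.keys_add[of s t]
      by (auto simp: K_def in_keys_iff)
    show "free_lift sX \<beta> (s + t) = free_lift sX \<beta> s + free_lift sX \<beta> t"
      by (simp add: free_lift_eq_sum[OF assms K(1)] K lookup_add X.scale_left_distrib
          sum.distrib split_def)
    show "free_lift sX \<beta> (free_scale c s) = sX c (free_lift sX \<beta> s)"
      by (simp add: free_lift_eq_sum[OF assms K(1)] K X.scale_sum_right split_def)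
  qed
qed

lemma free_lift_single:
  assumes "vector_space sX"
  shows "free_lift sX \<beta> (Poly_Mapping.single (a, b) c) = sX c (\<beta> a b)"
proof -
  interpret X: vector_space sX by fact
  show ?thesis
    by (simp add: free_lift_eq_sum[OF assms, of "{(a, b)}"])
qed

lemma the_elem_tensor_class:
  fixes sA :: "'k::field \<Rightarrow> 'b::ab_group_add \<Rightarrow> 'b"
  assumes "\<And>s t. s - t \<in> module.span free_scale (bilinear_relations sA) \<Longrightarrow> h s = h t"
  shows "the_elem (h ` tensor_class sA s) = h s"
proof -
  interpret F: vector_space "free_scale :: 'k \<Rightarrow> ('b \<times> 'b \<Rightarrow>\<^sub>0 'k) \<Rightarrow> _"
    by (rule vector_space_free_scale)
  have "s \<in> tensor_class sA s"
    by (simp add: tensor_class_def tensor_rel_def F.span_zero)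
  moreover have "h t = h s" if "t \<in> tensor_class sA s" for t
    using assms[of s t] that by (simp add: tensor_class_def tensor_rel_def)
  ultimately have "h ` tensor_class sA s = {h s}" by blast
  then show ?thesis by simp
qed

lemma tensor_lift_class:
  assumes X: "vector_space sX"
    and b1: "\<And>b. Vector_Spaces.linear sA sX (\<lambda>a. \<beta> a b)"
    and b2: "\<And>a. Vector_Spaces.linear sA sX (\<beta> a)"
  shows "tensor_lift sX \<beta> (tensor_class sA s) = free_lift sX \<beta> s"
  unfolding tensor_lift_def
proof (rule the_elem_tensor_class)
  fix s t :: "'c \<times> 'c \<Rightarrow>\<^sub>0 'a"
  interpret X: vector_space sX by fact
  interpret L: Vector_Spaces.linear free_scale sX "free_lift sX \<beta>"
    by (rule free_lift_linear[OF X])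
  have [simp]: "\<beta> (a + a') b = \<beta> a b + \<beta> a' b" "\<beta> (sA c a) b = sX c (\<beta> a b)"
    "\<beta> b (a + a') = \<beta> b a + \<beta> b a'" "\<beta> b (sA c a) = sX c (\<beta> b a)" for a a' b c
    using module_hom.add[OF b1[of b, unfolded Vector_Spaces.linear_iff_module_hom]]
      module_hom.scale[OF b1[of b, unfolded Vector_Spaces.linear_iff_module_hom]]
      module_hom.add[OF b2[of b, unfolded Vector_Spaces.linear_iff_module_hom]]
      module_hom.scale[OF b2[of b, unfolded Vector_Spaces.linear_iff_module_hom]]
    by auto
  have z: "free_lift sX \<beta> r = 0" if "r \<in> bilinear_relations sA" for r
    using that by (auto simp: bilinear_relations_def L.diff free_lift_single[OF X])
  assume "s - t \<in> module.span free_scale (bilinear_relations sA)"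
  then have "free_lift sX \<beta> (s - t) = 0"
    by (rule L.eq_0_on_span[OF z, rotated])
  then show "free_lift sX \<beta> s = free_lift sX \<beta> t" by (simp add: L.diff)
qed

lemma bilinear_relations_intros:
  "Poly_Mapping.single (a + b, x) 1 - Poly_Mapping.single (a, x) 1 - Poly_Mapping.single (b, x) 1
    \<in> bilinear_relations sA"
  "Poly_Mapping.single (x, a + b) 1 - Poly_Mapping.single (x, a) 1 - Poly_Mapping.single (x, b) 1
    \<in> bilinear_relations sA"
  "Poly_Mapping.single (sA c a, x) 1 - Poly_Mapping.single (a, x) c \<in> bilinear_relations sA"
  "Poly_Mapping.single (x, sA c a) 1 - Poly_Mapping.single (x, a) c \<in> bilinear_relations sA"
  unfolding bilinear_relations_def by blast+

lemma bilinear_relations_cases: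
  assumes "r \<in> bilinear_relations sA"
  obtains a b x where "r = Poly_Mapping.single (a + b, x) 1 - Poly_Mapping.single (a, x) 1
      - Poly_Mapping.single (b, x) 1"
  | a b x where "r = Poly_Mapping.single (x, a + b) 1 - Poly_Mapping.single (x, a) 1
      - Poly_Mapping.single (x, b) 1"
  | a c x where "r = Poly_Mapping.single (sA c a, x) 1 - Poly_Mapping.single (a, x) c"
  | a c x where "r = Poly_Mapping.single (x, sA c a) 1 - Poly_Mapping.single (x, a) c"
  using assms unfolding bilinear_relations_def by blast

lemma tensor_map_class:
  assumes p: "Vector_Spaces.linear sA sA p" and q: "Vector_Spaces.linear sA sA q"
  shows "tensor_map sA p q (tensor_class sA s) =
    tensor_class sA (free_lift free_scale (\<lambda>a b. Poly_Mapping.single (p a, q b) 1) s)"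
  unfolding tensor_map_def
proof (rule the_elem_tensor_class)
  fix s t :: "'b \<times> 'b \<Rightarrow>\<^sub>0 'a"
  let ?R = "bilinear_relations sA" and ?S = "Poly_Mapping.single :: _ \<Rightarrow> 'a \<Rightarrow> 'b \<times> 'b \<Rightarrow>\<^sub>0 'a"
  let ?h = "free_lift free_scale (\<lambda>a b. ?S (p a, q b) 1)"
  interpret p: Vector_Spaces.linear sA sA p by fact
  interpret q: Vector_Spaces.linear sA sA q by fact
  interpret L: Vector_Spaces.linear free_scale free_scale ?h
    by (rule free_lift_linear[OF vector_space_free_scale])
  have sc: "free_scale c (?S x 1) = ?S x c" for c x
    by (rule poly_mapping_eqI) (simp add: lookup_single when_def)
  have "?h r \<in> ?R" if "r \<in> ?R" for r
    by (rule bilinear_relations_cases[OF that])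
      (simp_all add: L.diff free_lift_single[OF vector_space_free_scale] sc
        p.add p.scale q.add q.scale bilinear_relations_intros)
  then have "?h ` module.span free_scale ?R \<subseteq> module.span free_scale ?R"
    unfolding L.span_image[symmetric] by (intro L.vs1.span_mono) blast
  moreover assume "s - t \<in> module.span free_scale ?R"
  ultimately have "(?h s, ?h t) \<in> tensor_rel sA"
    by (auto simp: tensor_rel_def L.diff[symmetric])
  then show "tensor_class sA (?h s) = tensor_class sA (?h t)"
    unfolding tensor_class_def by (rule equiv_class_eq[OF equiv_tensor_rel])
qed

lemma trace_on_eq:
  assumes sV: "vector_space sV"
    and B: "is_basis_of sV W B" "finite B"
    and T: "\<And>x y. x \<in> W \<Longrightarrow> y \<in> W \<Longrightarrow> T (x + y) = T x + T y"
      "\<And>c x. x \<in> W \<Longrightarrow> T (sV c x) = sV c (T x)"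
      "\<And>x. x \<in> W \<Longrightarrow> T x \<in> W"
  shows "trace_on sV W T = (\<Sum>b\<in>B. module.representation sV B (T b) b)"
proof -
  interpret V: vector_space sV by fact
  define C where "C = (SOME B. is_basis_of sV W B)"
  have C: "is_basis_of sV W C" unfolding C_def using B(1) by (rule someI)
  have iB: "V.independent B" "V.span B = W" and iC: "V.independent C" "V.span C = W"
    using B(1) C by (auto simp: is_basis_of_def)
  have inB: "b \<in> W" if "b \<in> B" for b using that iB V.span_base by blast
  have inC: "b \<in> W" if "b \<in> C" for b using that iC V.span_base by blast
  have fC: "finite C"
    using V.independent_span_bound[OF B(2) iC(1)] iB(2) inC by auto
  have WS: "V.subspace W" using V.subspace_span iB(2) by metis
  have T0: "T 0 = 0" using T(2)[of 0 0] V.subspace_0[OF WS] by simp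
  have Tsum: "T (\<Sum>i\<in>I. sV (c i) (x i)) = (\<Sum>i\<in>I. sV (c i) (T (x i)))"
    if "finite I" "\<And>i. i \<in> I \<Longrightarrow> x i \<in> W" for I :: "'b set" and c x
    using that
  proof (induction I)
    case (insert i I)
    then show ?case
      by (simp add: T V.subspace_scale[OF WS] V.subspace_sum[OF WS])
  qed (simp add: T0)
  have rsum: "V.representation D (\<Sum>i\<in>I. sV (c i) (x i)) d
      = (\<Sum>i\<in>I. c i * V.representation D (x i) d)"
    if "V.independent D" "V.span D = W" "\<And>i. i \<in> I \<Longrightarrow> x i \<in> W"
    for D d I and c :: "'b \<Rightarrow> 'a" and x
    using that by (subst V.representation_sum)
      (auto simp: V.representation_scale V.subspace_scale[OF WS] sum_distrib_left)
  have eB: "(\<Sum>b\<in>B. sV (V.representation B x b) b) = x" if "x \<in> W" for x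
    using V.sum_representation_eq[OF iB(1), of x B] iB(2) that B(2) by auto
  have eC: "(\<Sum>b\<in>C. sV (V.representation C x b) b) = x" if "x \<in> W" for x
    using V.sum_representation_eq[OF iC(1), of x C] iC(2) that fC by auto
  have "(\<Sum>b\<in>B. V.representation B (T b) b)
      = (\<Sum>b\<in>B. \<Sum>c\<in>C. V.representation C b c * V.representation B (T c) b)"
  proof (rule sum.cong[OF refl])
    fix b assume b: "b \<in> B"
    have "V.representation B (T b) b
        = V.representation B (T (\<Sum>c\<in>C. sV (V.representation C b c) c)) b"
      by (simp add: eC inB b)
    also have "\<dots> = V.representation B (\<Sum>c\<in>C. sV (V.representation C b c) (T c)) b"
      by (subst Tsum) (auto simp: fC inC)
    also have "\<dots> = (\<Sum>c\<in>C. V.representation C b c * V.representation B (T c) b)"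
      by (rule rsum) (auto simp: iB T inC)
    finally show "V.representation B (T b) b = \<dots>" .
  qed
  also have "\<dots> = (\<Sum>c\<in>C. \<Sum>b\<in>B. V.representation B (T c) b * V.representation C b c)"
    by (subst sum.swap) (simp add: mult.commute)
  also have "\<dots> = (\<Sum>c\<in>C. V.representation C (T c) c)"
  proof (rule sum.cong[OF refl])
    fix c assume c: "c \<in> C"
    have "(\<Sum>b\<in>B. V.representation B (T c) b * V.representation C b c)
        = V.representation C (\<Sum>b\<in>B. sV (V.representation B (T c) b) b) c"
      by (rule rsum[symmetric]) (auto simp: iC inB)
    then show "(\<Sum>b\<in>B. V.representation B (T c) b * V.representation C b c)
        = V.representation C (T c) c"
      by (simp add: eB T inC c)
  qed
  finally show ?thesis
    by (simp add: trace_on_def C_def[symmetric])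
qed

end

theory Submission
  imports Defs
begin

text \<open>
  Write \<open>E = \<Sum> E\<^sup>1 \<otimes> E\<^sup>2\<close> and regard \<open>Hom\<^sub>A(V, V\<^sup>\<or>)\<close> as a subspace of the space of all bilinear forms
  on \<open>V\<close>. The operator \<open>f \<mapsto> (v, w \<mapsto> \<Sum> f(E\<^sup>2 w, S(E\<^sup>1) g v))\<close> on bilinear forms takes values in
  \<open>Hom\<^sub>A(V, V\<^sup>\<or>)\<close>, and there it restricts to \<open>f \<mapsto> f\<^sup>\<or> \<circ> j\<close>. Hence its trace is the
  Frobenius--Schur indicator; computed on the forms \<open>e\<^sup>i \<otimes> e\<^sup>j\<close> for a basis of \<open>V\<close>, the same trace
  is \<open>\<Sum> \<chi>(S(E\<^sup>1) g E\<^sup>2)\<close>.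
\<close>

lemma vector_space_mult: "vector_space ((*) :: 'k::field \<Rightarrow> 'k \<Rightarrow> 'k)"
  by unfold_locales (simp_all add: algebra_simps)

lemma linear_iff_add_scale:
  assumes "vector_space s1" "vector_space s2"
  shows "Vector_Spaces.linear s1 s2 f \<longleftrightarrow>
    (\<forall>x y. f (x + y) = f x + f y) \<and> (\<forall>c x. f (s1 c x) = s2 c (f x))"
  using assms by (auto simp: Vector_Spaces.linear_iff)

lemma sum_fun_apply: "(\<Sum>i\<in>I. f i) x = (\<Sum>i\<in>I. f i x :: 'b::comm_monoid_add)"
  by (induction I rule: infinite_finite_induct) simp_all

section \<open>Traces on finite-dimensional subspaces of a possibly infinite-dimensional
  space\<close>

context vector_space
begin

text \<open>The \<open>\<phi> i\<close> are coordinate functionals: duality makes the family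
  \<open>e\<close> injective and independent, \<open>expand\<close> makes it span \<open>U\<close>,
  and so \<open>\<phi> i (T (e i))\<close> is the i-th diagonal entry of \<open>T\<close>. The
  second conclusion supplies the finite spanning set that \<open>trace_on_subspace\<close> asks
  for.\<close>

lemma trace_on_dual_basis:
  assumes "finite I" and U: "subspace U" "\<And>i. i \<in> I \<Longrightarrow> e i \<in> U"
    and \<phi>: "\<And>i. i \<in> I \<Longrightarrow> Vector_Spaces.linear scale (*) (\<phi> i)"
    and dual: "\<And>i j. i \<in> I \<Longrightarrow> j \<in> I \<Longrightarrow> \<phi> i (e j) = (if i = j then 1 else 0)"
    and expand: "\<And>x. x \<in> U \<Longrightarrow> (\<Sum>i\<in>I. scale (\<phi> i x) (e i)) = x"
    and T: "\<And>x y. x \<in> U \<Longrightarrow> y \<in> U \<Longrightarrow> T (x + y) = T x + T y"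
      "\<And>c x. x \<in> U \<Longrightarrow> T (scale c x) = scale c (T x)"
      "\<And>x. x \<in> U \<Longrightarrow> T x \<in> U"
  shows "trace_on scale U T = (\<Sum>i\<in>I. \<phi> i (T (e i)))" and "U \<subseteq> span (e ` I)"
proof -
  have inj: "inj_on e I"
    using dual by (intro inj_onI) (metis zero_neq_one)
  have \<phi>_sum: "\<phi> i (\<Sum>j\<in>I. scale (u (e j)) (e j)) = u (e i)" if "i \<in> I" for i u
  proof -
    interpret L: Vector_Spaces.linear scale "(*)" "\<phi> i" by (rule \<phi>[OF that])
    have "\<phi> i (\<Sum>j\<in>I. scale (u (e j)) (e j)) = (\<Sum>j\<in>I. if i = j then u (e j) else 0)"
      unfolding L.sum by (rule sum.cong) (use dual that in \<open>auto simp: L.scale\<close>)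
    then show ?thesis using that \<open>finite I\<close> by simp
  qed
  have indep: "independent (e ` I)"
  proof (rule independent_if_scalars_zero)
    fix u x assume u: "(\<Sum>x\<in>e ` I. scale (u x) x) = 0" and "x \<in> e ` I"
    then obtain i where i: "i \<in> I" "x = e i" by blast
    interpret L: Vector_Spaces.linear scale "(*)" "\<phi> i" by (rule \<phi>[OF i(1)])
    have "\<phi> i 0 = u x"
      using \<phi>_sum[OF i(1), of u] u by (simp add: sum.reindex[OF inj] i)
    then show "u x = 0" by simp
  qed (use \<open>finite I\<close> in simp)
  have "x \<in> span (e ` I)" if "x \<in> U" for x
    by (subst expand[OF that, symmetric]) (intro span_sum span_scale span_base imageI)
  then show sub: "U \<subseteq> span (e ` I)" by blast
  then have span: "span (e ` I) = U"
    using span_minimal[OF _ U(1), of "e ` I"] U(2) by blast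
  have rep: "representation (e ` I) x (e i) = \<phi> i x" if "x \<in> U" "i \<in> I" for x i
  proof -
    have "(\<Sum>j\<in>I. scale (representation (e ` I) x (e j)) (e j)) = x"
      using sum_representation_eq[OF indep, of x "e ` I"] that span \<open>finite I\<close>
      by (simp add: sum.reindex[OF inj])
    with \<phi>_sum[OF that(2), of "representation (e ` I) x"] show ?thesis by simp
  qed
  have "trace_on scale U T = (\<Sum>b\<in>e ` I. representation (e ` I) (T b) b)"
    by (rule trace_on_eq) (use vector_space_axioms indep span \<open>finite I\<close> T in
      \<open>auto simp: is_basis_of_def\<close>)
  also have "\<dots> = (\<Sum>i\<in>I. \<phi> i (T (e i)))"
    by (simp add: sum.reindex[OF inj] rep U(2) T(3))
  finally show "trace_on scale U T = (\<Sum>i\<in>I. \<phi> i (T (e i)))" .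
qed

text \<open>Extend a basis of \<open>W\<close> to a basis of \<open>U\<close>. Since
  \<open>Q\<close> maps all of \<open>U\<close> into \<open>W\<close>, the added basis vectors have
  zero diagonal entries. The finite set \<open>D\<close> expresses that \<open>U\<close> is
  finite-dimensional without asking this of the ambient space.\<close>

lemma trace_on_subspace:
  assumes U: "subspace U" "U \<subseteq> span D" "finite D"
    and W: "subspace W" "W \<subseteq> U"
    and Q: "\<And>x y. x \<in> U \<Longrightarrow> y \<in> U \<Longrightarrow> Q (x + y) = Q x + Q y"
      "\<And>c x. x \<in> U \<Longrightarrow> Q (scale c x) = scale c (Q x)"
      "\<And>x. x \<in> U \<Longrightarrow> Q x \<in> W"
    and T: "\<And>x. x \<in> W \<Longrightarrow> T x = Q x"
  shows "trace_on scale W T = trace_on scale U Q"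
proof -
  obtain C where C: "C \<subseteq> W" "independent C" "W \<subseteq> span C"
    using maximal_independent_subset[of W] by blast
  obtain B where B: "C \<subseteq> B" "B \<subseteq> U" "independent B" "U \<subseteq> span B"
    using maximal_independent_subset_extend[of C U] C W(2) by blast
  have sC: "span C = W" and sB: "span B = U"
    using C B U(1) W(1) span_minimal by blast+
  have fB: "finite B"
    using independent_span_bound[OF U(3) B(3)] B(2) U(2) by blast
  then have fC: "finite C" using B(1) finite_subset by blast
  have "trace_on scale W T = (\<Sum>b\<in>C. representation C (T b) b)"
    by (rule trace_on_eq)
      (use vector_space_axioms C(2) sC fC T Q W in
        \<open>auto simp: is_basis_of_def subspace_add subspace_scale subset_iff\<close>)
  also have "\<dots> = (\<Sum>b\<in>C. representation B (Q b) b)"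
  proof (rule sum.cong)
    fix b assume "b \<in> C"
    then have "b \<in> W" using C(1) by blast
    then show "representation C (T b) b = representation B (Q b) b"
      using representation_extend[OF B(3) _ B(1), of "Q b"] Q(3) W(2) sC T by auto
  qed simp
  \<comment> \<open>For \<open>b\<close> outside \<open>C\<close>, the vector \<open>Q b\<close>
    lies in \<open>span C\<close>, so its coordinate at \<open>b\<close> vanishes.\<close>
  also have "\<dots> = (\<Sum>b\<in>B. representation B (Q b) b)"
  proof (rule sum.mono_neutral_left[OF fB B(1)], rule ballI)
    fix b assume b: "b \<in> B - C"
    then have "Q b \<in> span C" using Q(3) B(2) sC by blast
    then have "representation B (Q b) = representation C (Q b)"
      by (rule representation_extend[OF B(3) _ B(1)])
    then show "representation B (Q b) b = 0"
      using representation_ne_zero[of C "Q b" b] b by auto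
  qed
  also have "\<dots> = trace_on scale U Q"
    by (rule trace_on_eq[symmetric])
      (use vector_space_axioms B(3) sB fB Q W in \<open>auto simp: is_basis_of_def\<close>)
  finally show ?thesis .
qed

end

section \<open>Sweedler notation on a representative of a tensor\<close>

lemma linear_free_lift:
  assumes "vector_space sX" "Vector_Spaces.linear sX sY L"
  shows "L (free_lift sX \<beta> s) = free_lift sY (\<lambda>a b. L (\<beta> a b)) s"
proof -
  interpret L: Vector_Spaces.linear sX sY L by fact
  show ?thesis by (simp add: free_lift_def L.sum L.scale split_def)
qed

lemma tensor_lift_tensor_map_class:
  fixes sA :: "'k::field \<Rightarrow> 'a::ab_group_add \<Rightarrow> 'a"
  assumes X: "vector_space sX"
    and b1: "\<And>b. Vector_Spaces.linear sA sX (\<lambda>a. \<beta> a b)"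
    and b2: "\<And>a. Vector_Spaces.linear sA sX (\<beta> a)"
    and p: "Vector_Spaces.linear sA sA p" and q: "Vector_Spaces.linear sA sA q"
  shows "tensor_lift sX \<beta> (tensor_map sA p q (tensor_class sA s)) =
    free_lift sX (\<lambda>a b. \<beta> (p a) (q b)) s"
proof -
  interpret X: vector_space sX by fact
  show ?thesis
    by (simp add: tensor_map_class[OF p q] tensor_lift_class[OF X b1 b2]
        linear_free_lift[OF vector_space_free_scale free_lift_linear[OF X]]
        free_lift_single[OF X])
qed

text \<open>Fixing a representative \<open>s\<close> turns sums over \<open>E\<close> into finite
  sums. The centrality axiom is an equality of cosets; applying to both sides the functional induced
  by a bilinear form \<open>\<beta>\<close> makes it an equality of scalars, the shape in which it
  is used.\<close>

lemma separability_idempotent_class: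
  assumes "k_algebra sA" "separability_idempotent sA E"
  obtains s where "E = tensor_class sA s"
    and "free_lift sA (*) s = 1"
    and "\<And>\<beta> a. (\<And>b. Vector_Spaces.linear sA (*) (\<lambda>a. \<beta> a b)) \<Longrightarrow>
      (\<And>a. Vector_Spaces.linear sA (*) (\<beta> a)) \<Longrightarrow>
      free_lift (*) (\<lambda>x y. \<beta> (a * x) y) s = free_lift (*) (\<lambda>x y. \<beta> x (y * a)) s"
proof -
  interpret k_algebra sA by fact
  have mult: "Vector_Spaces.linear sA sA (\<lambda>x. a * x)" "Vector_Spaces.linear sA sA (\<lambda>x. x * a)"
    "Vector_Spaces.linear sA sA id" for a
    by (simp_all add: linear_iff_add_scale[OF vector_space_axioms vector_space_axioms]
        algebra_simps scale_mult_left scale_mult_right)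
  obtain s where s: "E = tensor_class sA s"
    using assms(2) by (auto simp: separability_idempotent_def tensor_space_def tensor_class_def
        elim!: quotientE)
  show ?thesis
  proof
    show "E = tensor_class sA s" by fact
    show "free_lift sA (*) s = 1"
      using assms(2) tensor_lift_class[OF vector_space_axioms mult(2,1), of s]
      by (simp add: separability_idempotent_def s)
    fix \<beta> :: "'b \<Rightarrow> 'b \<Rightarrow> 'a" and a
    assume \<beta>: "\<And>b. Vector_Spaces.linear sA (*) (\<lambda>a. \<beta> a b)"
      "\<And>a. Vector_Spaces.linear sA (*) (\<beta> a)"
    have "tensor_map sA (\<lambda>x. a * x) id E = tensor_map sA id (\<lambda>y. y * a) E"
      using assms(2) by (simp add: separability_idempotent_def)
    then show "free_lift (*) (\<lambda>x y. \<beta> (a * x) y) s = free_lift (*) (\<lambda>x y. \<beta> x (y * a)) s"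
      using tensor_lift_tensor_map_class[OF vector_space_mult \<beta> mult(1,3), of a s]
        tensor_lift_tensor_map_class[OF vector_space_mult \<beta> mult(3,2), of a s]
      by (simp add: s)
  qed
qed

section \<open>The averaging operator on bilinear forms and its trace\<close>

theorem theorem3p8:
  fixes sA :: "'k::field \<Rightarrow> 'a::{ring,monoid_mult} \<Rightarrow> 'a"
    and S :: "'a \<Rightarrow> 'a" and g :: 'a
    and E :: "('a \<times> 'a \<Rightarrow>\<^sub>0 'k) set"
    and sV :: "'k \<Rightarrow> 'v::ab_group_add \<Rightarrow> 'v"
    and act :: "'a \<Rightarrow> 'v \<Rightarrow> 'v"
  assumes "CHAR('k) \<noteq> 2"
    and "pivotal_algebra sA S g"
    and "separability_idempotent sA E"
    and "left_module sA sV act"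
    and "finite_dimensional sV"
  shows "fs_indicator sV act S g = character sV act (tensor_lift sA (\<lambda>x y. S x * g * y) E)"
proof -
  interpret P: pivotal_algebra sA S g by fact
  interpret M: left_module sA sV act by fact
  obtain B where "finite_dimensional_vector_space sV B"
    using assms(5) by (auto simp: finite_dimensional_def)
  then interpret FV: finite_dimensional_vector_space sV B .
  interpret S: Vector_Spaces.linear sA sA S by (rule P.linear_S)
  obtain ginv where ginv: "ginv * g = 1" "\<And>a. S (S a) = g * a * ginv"
    using P.pivotal_element by blast
  note SS = P.S_one P.S_mult
  have SSg: "S (S a) * g = g * a" for a
    by (simp add: ginv mult.assoc)
  obtain s where s: "E = tensor_class sA s" "free_lift sA (*) s = 1"
    and swap: "\<And>\<beta> a. (\<And>b. Vector_Spaces.linear sA (*) (\<lambda>a. \<beta> a b)) \<Longrightarrow>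
      (\<And>a. Vector_Spaces.linear sA (*) (\<beta> a)) \<Longrightarrow>
      free_lift (*) (\<lambda>x y. \<beta> (a * x) y) s = free_lift (*) (\<lambda>x y. \<beta> x (y * a)) s"
    using separability_idempotent_class[OF P.k_algebra_axioms assms(3)] by blast
  \<comment> \<open>\<open>\<Phi> \<beta>\<close> stands for the sum of
    \<open>\<beta>(E\<^sup>1, E\<^sup>2)\<close>.\<close>
  define \<Phi> :: "('a \<Rightarrow> 'a \<Rightarrow> 'k) \<Rightarrow> 'k" where "\<Phi> \<beta> = free_lift (*) \<beta> s" for \<beta>
  have \<Phi>_sum: "\<Phi> \<beta> = (\<Sum>x\<in>Poly_Mapping.keys s. Poly_Mapping.lookup s x * \<beta> (fst x) (snd x))" for \<beta>
    by (simp add: \<Phi>_def free_lift_def split_def)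
  note lin_sV = linear_iff_add_scale[OF M.V.vector_space_axioms vector_space_mult]
  note lin_sA = linear_iff_add_scale[OF P.vector_space_axioms vector_space_mult]
  have hom_scale_apply [simp]: "hom_scale c f v w = c * f v w" for c and f :: "'v \<Rightarrow> 'v \<Rightarrow> 'k" and v w
    by (simp add: hom_scale_def dual_scale_def)
  have vs_dual: "vector_space (dual_scale :: 'k \<Rightarrow> ('v \<Rightarrow> 'k) \<Rightarrow> _)"
    by unfold_locales (auto simp: dual_scale_def algebra_simps)
  interpret H: vector_space "hom_scale :: 'k \<Rightarrow> ('v \<Rightarrow> 'v \<Rightarrow> 'k) \<Rightarrow> _"
    by unfold_locales (auto simp: fun_eq_iff algebra_simps)
  \<comment> \<open>A map f from V to its dual is the form \<open>f v w\<close>, the value of f(v)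
    at w: linearity in \<open>w\<close> says that f takes values in the dual, linearity in
    \<open>v\<close> that f is linear.\<close>
  define U :: "('v \<Rightarrow> 'v \<Rightarrow> 'k) set" where
    "U = {f. (\<forall>v. Vector_Spaces.linear sV (*) (f v)) \<and>
      (\<forall>w. Vector_Spaces.linear sV (*) (\<lambda>v. f v w))}"
  have Uiff: "f \<in> U \<longleftrightarrow> (\<forall>v w w'. f v (w + w') = f v w + f v w') \<and>
      (\<forall>v v' w. f (v + v') w = f v w + f v' w) \<and>
      (\<forall>c v w. f v (sV c w) = c * f v w) \<and> (\<forall>c v w. f (sV c v) w = c * f v w)" for f
    unfolding U_def lin_sV by blast
  define W where "W = hom_to_dual sV act S"
  have Wiff: "f \<in> W \<longleftrightarrow> f \<in> U \<and> (\<forall>a v w. f (act a v) w = f v (act (S a) w))" for f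
    unfolding W_def hom_to_dual_def module_homs_def Uiff
      linear_iff_add_scale[OF M.V.vector_space_axioms vs_dual] dual_def
    by (auto simp: lin_sV fun_eq_iff dual_scale_def dual_act_def image_subset_iff)
  have UD: "f v (w + w') = f v w + f v w'" "f (v + v') w = f v w + f v' w"
    "f v (sV c w) = c * f v w" "f (sV c v) w = c * f v w" if "f \<in> U" for f v w v' w' c
    using that by (auto simp: Uiff)
  have U: "H.subspace U"
    by (rule H.subspaceI) (auto simp: Uiff algebra_simps)
  have W: "H.subspace W" "W \<subseteq> U"
    using U by (auto simp: Wiff H.subspace_def)
  note act_simps = M.act_add_left M.act_add_right M.act_scale_left M.act_scale_right
  define Q :: "('v \<Rightarrow> 'v \<Rightarrow> 'k) \<Rightarrow> 'v \<Rightarrow> 'v \<Rightarrow> 'k" where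
    "Q f v w = \<Phi> (\<lambda>x y. f (act y w) (act (S x * g) v))" for f v w
  have bil: "Vector_Spaces.linear sA (*) (\<lambda>x. f (act y w) (act (S x * g) v))"
      "Vector_Spaces.linear sA (*) (\<lambda>y. f (act y w) (act (S x * g) v))" if "f \<in> U" for f v w x y
    unfolding lin_sA
    by (auto simp: act_simps UD[OF that] S.add S.scale P.scale_mult_left algebra_simps)
  have Q_add: "Q (f + h) = Q f + Q h" and Q_scale: "Q (hom_scale c f) = hom_scale c (Q f)"
    for f h c
    by (simp_all add: fun_eq_iff Q_def \<Phi>_sum algebra_simps sum.distrib sum_distrib_left)
  have QU: "Q f \<in> U" if "f \<in> U" for f
    by (auto simp: Uiff Q_def \<Phi>_sum act_simps UD[OF that] algebra_simps sum.distrib sum_distrib_left)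
  have QW: "Q f \<in> W" if f: "f \<in> U" for f
  proof -
    have "Q f (act a v) w = Q f v (act (S a) w)" for a v w
    proof -
      \<comment> \<open>Moving \<open>a\<close> to the left past \<open>g\<close> turns it into
        \<open>S (S a)\<close>, which the antimultiplicative \<open>S\<close> absorbs. The factor
        \<open>S a\<close> then stands to the left of \<open>x\<close>, and centrality of E carries
        it to the right of \<open>y\<close>.\<close>
      have "S x * g * a = S (S a * x) * g" for x
        by (simp add: SS SSg mult.assoc)
      then have "Q f (act a v) w = \<Phi> (\<lambda>x y. f (act y w) (act (S (S a * x) * g) v))"
        by (simp add: Q_def M.act_mult[symmetric])
      also have "\<dots> = \<Phi> (\<lambda>x y. f (act (y * S a) w) (act (S x * g) v))"
        unfolding \<Phi>_def by (rule swap) (rule bil[OF f])+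
      also have "\<dots> = Q f v (act (S a) w)"
        by (simp add: Q_def M.act_mult)
      finally show ?thesis .
    qed
    with QU[OF f] show ?thesis by (simp add: Wiff)
  qed
  have QT: "transpose_map f \<circ> pivotal_map sV act g = Q f" if f: "f \<in> W" for f
  proof (intro ext)
    fix v w
    have fU: "f \<in> U" using f W(2) by blast
    \<comment> \<open>A-linearity of \<open>f\<close> trades \<open>S x\<close> on the second
      argument for \<open>x\<close> on the first. Only the product \<open>x * y\<close> remains, and
      it sums to 1 over E.\<close>
    have "f (act y w) (act (S x * g) v) = f (act (x * y) w) (act g v)" for x y
      using f by (simp add: Wiff M.act_mult)
    then have "Q f v w = \<Phi> (\<lambda>x y. f (act (x * y) w) (act g v))"
      by (simp add: Q_def)
    also have "\<dots> = f (act (free_lift sA (*) s) w) (act g v)"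
      unfolding \<Phi>_def
      by (rule linear_free_lift[symmetric, OF P.vector_space_axioms])
        (auto simp: lin_sA act_simps UD[OF fU])
    also have "\<dots> = f w (act g v)" by (simp add: s(2) M.act_one)
    \<comment> \<open>The bounded abstraction in \<open>pivotal_map\<close> is harmless: it is
      evaluated at \<open>f w\<close>, which lies in \<open>dual sV\<close>.\<close>
    also have "\<dots> = (transpose_map f \<circ> pivotal_map sV act g) v w"
      using fU by (simp add: transpose_map_def pivotal_map_def dual_def U_def)
    finally show "(transpose_map f \<circ> pivotal_map sV act g) v w = Q f v w" by simp
  qed

  \<comment> \<open>Coordinates on V and on bilinear forms\<close>
  let ?r = "M.V.representation B"
  have r_sum: "(\<Sum>b\<in>B. sV (?r v b) b) = v" for v
    by (rule M.V.sum_representation_eq)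
      (use FV.independent_Basis FV.span_Basis FV.finite_Basis in auto)
  have r_lin: "Vector_Spaces.linear sV (*) (\<lambda>v. ?r v b)" for b
    by (auto simp: lin_sV M.V.representation_add M.V.representation_scale
        FV.independent_Basis FV.span_Basis)
  have r_basis: "?r c b = (if b = c then 1 else 0)" if "c \<in> B" for b c
    using that by (simp add: M.V.representation_basis[OF FV.independent_Basis])
  have char: "character sV act a = (\<Sum>b\<in>B. ?r (act a b) b)" for a
    unfolding character_def
    by (rule M.V.trace_on_dual_basis(1))
      (simp_all add: FV.finite_Basis r_lin r_basis r_sum act_simps)
  \<comment> \<open>For \<open>p = (b, c)\<close> this is the tensor product of the coordinate
    functionals at \<open>b\<close> and \<open>c\<close>. These forms are a basis of
    \<open>U\<close>, and the coordinate functional belonging to \<open>p\<close> is evaluation at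
    \<open>(b, c)\<close>.\<close>
  define e where "e p v w = ?r v (fst p) * ?r w (snd p)" for p v w
  have f_expand: "(\<Sum>p\<in>B \<times> B. hom_scale (f (fst p) (snd p)) (e p)) = f" if f: "f \<in> U" for f
  proof (intro ext)
    fix v w
    have lin: "Vector_Spaces.linear sV (*) (f v)" "Vector_Spaces.linear sV (*) (\<lambda>v. f v w)" for v w
      using f by (auto simp: U_def)
    interpret f1: Vector_Spaces.linear sV "(*)" "\<lambda>v. f v w" by (rule lin)
    have fs: "f b w = (\<Sum>c\<in>B. ?r w c * f b c)" for b
    proof -
      interpret f2: Vector_Spaces.linear sV "(*)" "f b" by (rule lin)
      show ?thesis by (subst r_sum[of w, symmetric]) (simp only: f2.sum f2.scale)
    qed
    have "f v w = (\<Sum>b\<in>B. ?r v b * f b w)"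
      by (subst r_sum[of v, symmetric]) (simp only: f1.sum f1.scale)
    also have "\<dots> = (\<Sum>b\<in>B. \<Sum>c\<in>B. ?r v b * (?r w c * f b c))"
      by (simp only: fs sum_distrib_left)
    also have "\<dots> = (\<Sum>p\<in>B \<times> B. ?r v (fst p) * (?r w (snd p) * f (fst p) (snd p)))"
      by (simp add: sum.cartesian_product split_def)
    also have "\<dots> = (\<Sum>p\<in>B \<times> B. hom_scale (f (fst p) (snd p)) (e p)) v w"
      by (simp only: sum_fun_apply hom_scale_apply e_def mult_ac)
    finally show "(\<Sum>p\<in>B \<times> B. hom_scale (f (fst p) (snd p)) (e p)) v w = f v w" by simp
  qed
  have eU: "e p \<in> U" for p
    using r_lin by (auto simp: Uiff e_def lin_sV algebra_simps)
  have tr: "trace_on hom_scale U Q = (\<Sum>p\<in>B \<times> B. Q (e p) (fst p) (snd p))"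
    and UD': "U \<subseteq> H.span (e ` (B \<times> B))"
  proof -
    have l: "Vector_Spaces.linear hom_scale (*) (\<lambda>f :: 'v \<Rightarrow> 'v \<Rightarrow> 'k. f (fst p) (snd p))" for p :: "'v \<times> 'v"
      by (simp add: linear_iff_add_scale[OF H.vector_space_axioms vector_space_mult])
    note * = H.trace_on_dual_basis[where I = "B \<times> B" and \<phi> = "\<lambda>p f. f (fst p) (snd p)"
        and e = e and U = U and T = Q, OF _ U eU l]
    show "trace_on hom_scale U Q = (\<Sum>p\<in>B \<times> B. Q (e p) (fst p) (snd p))"
      by (rule *(1)) (use f_expand FV.finite_Basis in
        \<open>auto simp: Q_add Q_scale QU e_def r_basis split: if_splits\<close>)
    show "U \<subseteq> H.span (e ` (B \<times> B))"
      by (rule *(2)) (use f_expand FV.finite_Basis in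
        \<open>auto simp: Q_add Q_scale QU e_def r_basis split: if_splits\<close>)
  qed
  have "fs_indicator sV act S g = trace_on hom_scale U Q"
    unfolding fs_indicator_def W_def[symmetric]
    by (rule H.trace_on_subspace[OF U UD' _ W Q_add Q_scale QW QT])
      (simp add: FV.finite_Basis)
  also have "\<dots> = (\<Sum>b\<in>B. \<Sum>c\<in>B. \<Phi> (\<lambda>x y. ?r (act y c) b * ?r (act (S x * g) b) c))"
    by (simp add: tr e_def Q_def sum.cartesian_product split_def)
  \<comment> \<open>The order of summation is exchanged so that the inner sum over \<open>b\<close>
    becomes a matrix product, with left factor the matrix of \<open>S x * g\<close>; the outer sum
    over \<open>c\<close> then takes its trace.\<close>
  also have "\<dots> = \<Phi> (\<lambda>x y. \<Sum>c\<in>B. \<Sum>b\<in>B. ?r (act y c) b * ?r (act (S x * g) b) c)"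
  proof -
    have 1: "\<Phi> (\<lambda>x y. \<Sum>i\<in>B. \<beta> i x y) = (\<Sum>i\<in>B. \<Phi> (\<beta> i))" for \<beta>
      by (simp add: \<Phi>_sum sum_distrib_left) (rule sum.swap)
    show ?thesis by (simp add: 1) (rule sum.swap)
  qed
  also have "\<dots> = \<Phi> (\<lambda>x y. character sV act (S x * g * y))"
  proof -
    \<comment> \<open>Used with \<open>a = S x * g\<close> and \<open>v = act y c\<close>.\<close>
    have "(\<Sum>b\<in>B. ?r v b * ?r (act a b) c) = ?r (act a v) c" for a v c
    proof -
      have "Vector_Spaces.linear sV (*) (\<lambda>v. ?r (act a v) c)"
        using r_lin by (auto simp: lin_sV act_simps)
      then interpret L: Vector_Spaces.linear sV "(*)" "\<lambda>v. ?r (act a v) c" .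
      show ?thesis by (subst (2) r_sum[of v, symmetric]) (simp only: L.sum L.scale)
    qed
    then show ?thesis by (simp add: char M.act_mult[of "S _ * g"])
  qed
  also have "\<dots> = character sV act (free_lift sA (\<lambda>x y. S x * g * y) s)"
  proof -
    have "Vector_Spaces.linear sA (*) (character sV act)"
      using r_lin by (auto simp: char lin_sA lin_sV act_simps sum.distrib sum_distrib_left)
    then show ?thesis
      by (simp add: \<Phi>_def linear_free_lift[OF P.vector_space_axioms])
  qed
  also have "free_lift sA (\<lambda>x y. S x * g * y) s = tensor_lift sA (\<lambda>x y. S x * g * y) E"
    unfolding s(1)
    by (rule tensor_lift_class[symmetric])
      (auto simp: linear_iff_add_scale[OF P.vector_space_axioms P.vector_space_axioms]
        P.vector_space_axioms S.add S.scale P.scale_mult_left P.scale_mult_right algebra_simps)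
  finally show ?thesis .
qed

end
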